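(* Let $X$ be a (real or complex) infinite-dimensional separable Banach space and let $A$ be a hypercyclic linear operator in $X$ satisfying the following: $A$ is densely defined, each power $A^n$ ($n\in\mathbb N$) is a closed operator, and there exist a set $Y\subseteq C^\infty(A):=\bigcap_{n=1}^\infty D(A^n)$ dense in $X$ and a mapping $B:Y\to Y$ such that (1) for every $f\in Y$: $ABf=f$; and (2) for every $f\in Y$: $A^nf\to 0$ and $B^nf\to 0$ as $n\to\infty$. Then each power $A^n$ ($n\in\mathbb N$) is hypercyclic.
   Context: Operators may be unbounded; $D(\cdot)$ denotes the domain of an operator. The mapping $B:Y\to Y$ is not assumed linear or continuous, and $Y$ is only a set. A linear operator $T$ in a Banach space $X$ is called hypercyclic if there is a nonzero vector $f\in\bigcap_{n=0}^\infty D(T^n)$ (with $T^0:=I$) whose orbit $\{T^nf\}_{n\ge 0}$ is dense in $X$. *)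

theory Defs
  imports "HOL-Analysis.Analysis"
begin

text \<open>
  Real and complex Banach spaces are treated at once. The underlying real Banach space is the
  type \<open>'a::banach\<close>; the scalar field \<open>'k::real_normed_field\<close> acts by \<open>smul\<close>, extending the
  real scalar multiplication with a multiplicative norm. Up to isometric isomorphism the reals and
  the complex numbers are the only real normed fields, so these are exactly the two cases:
  for \<open>'k = real\<close> necessarily \<open>smul = scaleR\<close>, and for \<open>'k = complex\<close> this is a complex
  Banach space.
\<close>

locale banach_space_over = vector_space smul
  for smul :: "'k::real_normed_field \<Rightarrow> 'a::banach \<Rightarrow> 'a" +
  assumes smul_of_real: "smul (of_real r) x = r *\<^sub>R x"
    and norm_smul: "norm (smul c x) = norm c * norm x"

lemma banach_space_over_real: "banach_space_over (scaleR :: real \<Rightarrow> 'a::banach \<Rightarrow> 'a)"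
  by unfold_locales (simp_all add: algebra_simps)

lemma banach_space_over_complex: "banach_space_over ((*) :: complex \<Rightarrow> complex \<Rightarrow> complex)"
  by unfold_locales (simp_all add: algebra_simps norm_mult scaleR_conv_of_real)

definition infinite_dimensional :: "('k::field \<Rightarrow> 'a::ab_group_add \<Rightarrow> 'a) \<Rightarrow> bool" where
  "infinite_dimensional smul \<longleftrightarrow> \<not> (\<exists>Basis. finite_dimensional_vector_space smul Basis)"

text \<open>
  A possibly unbounded operator in \<open>'a\<close> is a partial map \<open>A :: 'a \<rightharpoonup> 'a\<close> with domain
  \<open>dom A\<close>; its value at \<open>f \<in> dom A\<close> is \<open>the (A f)\<close>.
\<close>

definition linear_operator ::
    "('k::field \<Rightarrow> 'a::ab_group_add \<Rightarrow> 'a) \<Rightarrow> ('a \<rightharpoonup> 'a) \<Rightarrow> bool" where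
  "linear_operator smul A \<longleftrightarrow>
     module.subspace smul (dom A) \<and>
     (\<forall>f\<in>dom A. \<forall>g\<in>dom A. the (A (f + g)) = the (A f) + the (A g)) \<and>
     (\<forall>c. \<forall>f\<in>dom A. the (A (smul c f)) = smul c (the (A f)))"

text \<open>
  Powers have their natural domains: \<open>f\<close> lies in the domain of the power \<open>Suc n\<close> iff it lies in
  the domain of the power \<open>n\<close> and its image there lies in \<open>dom A\<close>.
\<close>

primrec op_pow :: "('a \<rightharpoonup> 'a) \<Rightarrow> nat \<Rightarrow> ('a \<rightharpoonup> 'a)" where
  "op_pow A 0 = Some"
| "op_pow A (Suc n) = A \<circ>\<^sub>m op_pow A n"

definition densely_defined :: "('a::topological_space \<rightharpoonup> 'a) \<Rightarrow> bool" where
  "densely_defined A \<longleftrightarrow> closure (dom A) = UNIV"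

definition closed_operator :: "('a::topological_space \<rightharpoonup> 'a) \<Rightarrow> bool" where
  "closed_operator A \<longleftrightarrow> closed (Map.graph A)"

definition C_infinity :: "('a \<rightharpoonup> 'a) \<Rightarrow> 'a set" where
  "C_infinity A = (\<Inter>n\<in>{1..}. dom (op_pow A n))"

definition hypercyclic ::
    "('k::field \<Rightarrow> 'a::real_normed_vector \<Rightarrow> 'a) \<Rightarrow> ('a \<rightharpoonup> 'a) \<Rightarrow> bool" where
  "hypercyclic smul T \<longleftrightarrow> linear_operator smul T \<and>
     (\<exists>f. f \<noteq> 0 \<and> f \<in> (\<Inter>n. dom (op_pow T n)) \<and>
          closure (range (\<lambda>n. the (op_pow T n f))) = UNIV)"

end

theory Submission
  imports Defs
begin

text \<open>
  Every power \<open>T = A\<^sup>n\<close> inherits the hypotheses with \<open>B\<^sup>n\<close> in place of \<open>B\<close>, so a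
  hypercyclicity criterion for \<open>T\<close> suffices. Pick \<open>y\<^sub>k \<in> Y\<close> approximating a dense sequence in which
  each term recurs infinitely often, and exponents \<open>m\<^sub>k\<close> with gaps so large that the series
  \<open>f = \<Sum>\<^sub>i B\<^bsup>m\<^sub>i\<^esup> y\<^sub>i\<close> converges and so does its termwise image under \<open>T\<^bsup>m\<^sub>k\<^esup>\<close>: there the
  terms with \<open>i > k\<close> are \<open>B\<^bsup>m\<^sub>i - m\<^sub>k\<^esup> y\<^sub>i\<close>, those with \<open>i < k\<close> are \<open>T\<^bsup>m\<^sub>k - m\<^sub>i\<^esup> y\<^sub>i\<close>, and both
  contribute little. Closedness of \<open>T\<^bsup>m\<^sub>k\<^esup>\<close> yields \<open>f \<in> D(T\<^bsup>m\<^sub>k\<^esup>)\<close> and \<open>T\<^bsup>m\<^sub>k\<^esup> f \<approx> y\<^sub>k\<close>.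
\<close>

section \<open>Powers of a partial map and their domains\<close>

lemma op_pow_add: "op_pow A (m + n) = op_pow A m \<circ>\<^sub>m op_pow A n"
proof (induction m)
  case 0
  show ?case by (simp add: map_comp_def fun_eq_iff split: option.split)
next
  case (Suc m)
  then show ?case by (simp add: map_comp_def fun_eq_iff split: option.split)
qed

lemma op_pow_mult: "op_pow A (n * m) = op_pow (op_pow A n) m"
proof (induction m)
  case (Suc m)
  then show ?case using op_pow_add[of A n "n * m"] by simp
qed simp

lemma dom_op_pow_antimono:
  assumes "m \<le> n"
  shows "dom (op_pow A n) \<subseteq> dom (op_pow A m)"
proof -
  have "op_pow A n = op_pow A (n - m) \<circ>\<^sub>m op_pow A m"
    using assms by (metis op_pow_add le_add_diff_inverse2)
  then show ?thesis by (auto simp: map_comp_Some_iff)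
qed

lemma C_infinity_iff: "f \<in> C_infinity A \<longleftrightarrow> (\<forall>n. f \<in> dom (op_pow A n))"
proof
  assume f: "f \<in> C_infinity A"
  have "f \<in> dom (op_pow A n)" for n
  proof (cases n)
    case (Suc k)
    then have "n \<in> {1..}" by simp
    with f show ?thesis unfolding C_infinity_def by blast
  qed auto
  then show "\<forall>n. f \<in> dom (op_pow A n)" ..
qed (simp add: C_infinity_def)

section \<open>Linear partial operators\<close>

text \<open>Equations between \<open>Some\<close> values carry the domain conditions along, so
  linearity passes to compositions and finite sums without separate subspace arguments.\<close>

lemma linear_operator_iff:
  assumes "vector_space smul"
  shows "linear_operator smul A \<longleftrightarrow> A 0 = Some 0 \<and>
    (\<forall>f g a b. A f = Some a \<longrightarrow> A g = Some b \<longrightarrow> A (f + g) = Some (a + b)) \<and>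
    (\<forall>c f a. A f = Some a \<longrightarrow> A (smul c f) = Some (smul c a))"
    (is "?L \<longleftrightarrow> ?R")
proof -
  interpret vector_space smul by fact
  show ?thesis
  proof
    assume L: ?L
    then have sub: "subspace (dom A)"
      unfolding linear_operator_def by simp
    have add: "the (A (f + g)) = the (A f) + the (A g)" if "f \<in> dom A" "g \<in> dom A" for f g
      using L that unfolding linear_operator_def by blast
    have scl: "the (A (smul c f)) = smul c (the (A f))" if "f \<in> dom A" for c f
      using L that unfolding linear_operator_def by blast
    obtain z where z: "A 0 = Some z" using subspace_0[OF sub] by auto
    with add[of 0 0] have "z = 0" by auto
    moreover have "A (f + g) = Some (a + b)" if "A f = Some a" "A g = Some b" for f g a b
      using subspace_add[OF sub, of f g] add[OF domI domI, OF that] that by force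
    moreover have "A (smul c f) = Some (smul c a)" if "A f = Some a" for c f a
      using subspace_scale[OF sub, of f c] scl[of f c] that by (metis domD domI option.sel)
    ultimately show ?R using z by blast
  next
    assume R: ?R
    then show ?L
      unfolding linear_operator_def subspace_def by auto
  qed
qed

lemma linear_operator_op_pow:
  assumes "vector_space smul" "linear_operator smul A"
  shows "linear_operator smul (op_pow A n)"
proof (induction n)
  case 0
  then show ?case by (simp add: linear_operator_iff[OF assms(1)])
next
  case (Suc n)
  note lin = assms(2)[unfolded linear_operator_iff[OF assms(1)]]
    and IH = Suc.IH[unfolded linear_operator_iff[OF assms(1)]]
  show ?case
    unfolding linear_operator_iff[OF assms(1)] op_pow.simps
  proof (intro conjI allI impI)
    show "(A \<circ>\<^sub>m op_pow A n) 0 = Some 0"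
      using conjunct1[OF lin] conjunct1[OF IH] by simp
    show "(A \<circ>\<^sub>m op_pow A n) (f + g) = Some (a + b)"
      if fg: "(A \<circ>\<^sub>m op_pow A n) f = Some a" "(A \<circ>\<^sub>m op_pow A n) g = Some b" for f g a b
    proof -
      from fg obtain f' g' where "op_pow A n f = Some f'" "A f' = Some a"
        "op_pow A n g = Some g'" "A g' = Some b"
        by (auto simp: map_comp_Some_iff)
      moreover from this have "op_pow A n (f + g) = Some (f' + g')"
        using IH by blast
      ultimately show ?thesis using lin by simp
    qed
    show "(A \<circ>\<^sub>m op_pow A n) (smul c f) = Some (smul c a)"
      if f: "(A \<circ>\<^sub>m op_pow A n) f = Some a" for c f a
    proof -
      from f obtain f' where "op_pow A n f = Some f'" "A f' = Some a"
        by (auto simp: map_comp_Some_iff)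
      moreover from this have "op_pow A n (smul c f) = Some (smul c f')"
        using IH by blast
      ultimately show ?thesis using lin by simp
    qed
  qed
qed

lemma linear_operator_sum:
  assumes "vector_space smul" "linear_operator smul A"
    and "\<And>i. i \<in> I \<Longrightarrow> A (x i) = Some (y i)"
  shows "A (\<Sum>i\<in>I. x i) = Some (\<Sum>i\<in>I. y i)"
proof -
  have zero: "A 0 = Some 0"
    and add: "\<And>f g a b. A f = Some a \<Longrightarrow> A g = Some b \<Longrightarrow> A (f + g) = Some (a + b)"
    using assms(2) unfolding linear_operator_iff[OF assms(1)] by blast+
  show ?thesis
    \<comment> \<open>For infinite \<open>I\<close> both sums are 0 by convention, so
      \<open>zero\<close> settles that case too.\<close>
    using assms(3) by (induction I rule: infinite_finite_induct) (simp_all add: zero add)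
qed

section \<open>Series under closed operators, cancellation of \<open>B\<close>, and density\<close>

text \<open>Pairs of partial sums lie in the graph and converge to \<open>(f, g)\<close>, so a
  closed graph contains the limit. In particular \<open>f\<close> lies in the domain, which
  linearity alone would not give.\<close>

lemma closed_operator_sums:
  fixes T :: "'a::real_normed_vector \<rightharpoonup> 'a"
  assumes "vector_space smul" "linear_operator smul T" "closed_operator T"
    and "\<And>i. T (x i) = Some (y i)" "x sums f" "y sums g"
  shows "T f = Some g"
proof -
  have "(\<lambda>n. (\<Sum>i<n. x i, \<Sum>i<n. y i)) \<longlonglongrightarrow> (f, g)"
    using assms(5,6) unfolding sums_def by (rule tendsto_Pair)
  moreover have "(\<Sum>i<n. x i, \<Sum>i<n. y i) \<in> Map.graph T" for n
    using linear_operator_sum[OF assms(1,2,4)] by (auto simp: Map.graph_def)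
  ultimately have "(f, g) \<in> Map.graph T"
    using assms(3) unfolding closed_operator_def by (meson closed_sequentially)
  then show ?thesis by (simp add: Map.graph_def)
qed

lemma op_pow_right_inverse_ge:
  assumes "B \<in> Y \<rightarrow> Y" "\<And>f. f \<in> Y \<Longrightarrow> A (B f) = Some f" "y \<in> Y" "m \<le> k"
  shows "op_pow A m ((B ^^ k) y) = Some ((B ^^ (k - m)) y)"
proof -
  have Y: "(B ^^ j) y \<in> Y" for j
    using assms(1,3) by (induction j) auto
  \<comment> \<open>The surplus \<open>j\<close> stays arbitrary: the hypothesis at
    \<open>Suc j\<close> leaves one \<open>B\<close> outermost for the last \<open>A\<close> to
    cancel.\<close>
  have "op_pow A m ((B ^^ (m + j)) y) = Some ((B ^^ j) y)" for j
  proof (induction m arbitrary: j)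
    case (Suc m)
    from Suc[of "Suc j"] show ?case
      using assms(2)[OF Y[of j]] by simp
  qed simp
  from this[of "k - m"] show ?thesis using assms(4) by simp
qed

text \<open>The first \<open>m\<close> applications of \<open>A\<close> undo the power of
  \<open>B\<close>. As an equality of options it also transfers definedness.\<close>

lemma op_pow_right_inverse_le:
  assumes "B \<in> Y \<rightarrow> Y" "\<And>f. f \<in> Y \<Longrightarrow> A (B f) = Some f" "y \<in> Y" "m \<le> k"
  shows "op_pow A k ((B ^^ m) y) = op_pow A (k - m) y"
proof -
  have "op_pow A k = op_pow A (k - m) \<circ>\<^sub>m op_pow A m"
    using assms(4) by (metis op_pow_add le_add_diff_inverse2)
  then show ?thesis
    using op_pow_right_inverse_ge[OF assms(1-3) order.refl] by simp
qed

text \<open>The first component of \<open>prod_decode\<close> takes each value \<open>i\<close>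
  infinitely often, at the indices \<open>prod_encode (i, j)\<close>. Along these the error tends to
  0, so \<open>w\<close> converges to \<open>d i\<close> there.\<close>

lemma dense_range_if_recurrent_approx:
  fixes d w :: "nat \<Rightarrow> 'a::metric_space"
  assumes "closure (range d) = UNIV" "e \<longlonglongrightarrow> 0"
    and "\<And>k. dist (w k) (d (fst (prod_decode k))) \<le> e k"
  shows "closure (range w) = UNIV"
proof -
  have "d i \<in> closure (range w)" for i
  proof -
    have "filterlim (\<lambda>j. prod_encode (i, j)) at_top sequentially"
      by (rule filterlim_at_top_mono[OF filterlim_ident]) (simp add: le_prod_encode_2)
    with assms(2) have "(\<lambda>j. e (prod_encode (i, j))) \<longlonglongrightarrow> 0"
      by (rule filterlim_compose)
    then have "(\<lambda>j. dist (w (prod_encode (i, j))) (d i)) \<longlonglongrightarrow> 0"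
      by (rule Lim_null_comparison[rotated])
        (use assms(3)[of "prod_encode (i, _)"] in auto)
    then have "(\<lambda>j. w (prod_encode (i, j))) \<longlonglongrightarrow> d i"
      by (rule tendsto_dist_iff[THEN iffD2])
    then show ?thesis unfolding closure_sequential
      by (intro exI[where x = "\<lambda>j. w (prod_encode (i, j))"]) simp
  qed
  then have "closure (range d) \<subseteq> closure (range w)"
    by (intro closure_minimal) auto
  with assms(1) show ?thesis by auto
qed

section \<open>A Kitai-type hypercyclicity criterion\<close>

text \<open>Closedness is asked of every power, since powers of a closed unbounded operator need not
  be closed.\<close>

lemma hypercyclicity_criterion:
  fixes smul :: "'k::field \<Rightarrow> 'a::banach \<Rightarrow> 'a"
    and T :: "'a \<rightharpoonup> 'a"
    and B :: "'a \<Rightarrow> 'a"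
  assumes vs: "vector_space smul"
    and sep: "separable_space (euclidean :: 'a topology)"
    and nontriv: "(UNIV :: 'a set) \<noteq> {0}"
    and lin: "linear_operator smul T"
    and closed: "\<And>n. n \<ge> 1 \<Longrightarrow> closed_operator (op_pow T n)"
    and YC: "Y \<subseteq> C_infinity T"
    and Y_dense: "closure Y = UNIV"
    and BY: "B \<in> Y \<rightarrow> Y"
    and TB: "\<And>f. f \<in> Y \<Longrightarrow> T (B f) = Some f"
    and T0: "\<And>f. f \<in> Y \<Longrightarrow> (\<lambda>n. the (op_pow T n f)) \<longlonglongrightarrow> 0"
    and B0: "\<And>f. f \<in> Y \<Longrightarrow> (\<lambda>n. (B ^^ n) f) \<longlonglongrightarrow> 0"
  shows "hypercyclic smul T"
proof -
  obtain d :: "nat \<Rightarrow> 'a" where d: "closure (range d) = UNIV"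
  proof -
    from sep obtain D :: "'a set" where "countable D" and D: "closure D = UNIV"
      unfolding separable_space_def by auto
    from D have "D \<noteq> {}" by auto
    with \<open>countable D\<close> D that[of "from_nat_into D"] show ?thesis
      by (simp add: range_from_nat_into)
  qed
  have "\<exists>y\<in>Y. dist y (d (fst (prod_decode k))) < inverse (real (Suc k))" for k
    using Y_dense closure_approachable
    by (metis UNIV_I inverse_positive_iff_positive of_nat_0_less_iff zero_less_Suc)
  then obtain y where y: "\<And>k. y k \<in> Y"
    and yd: "\<And>k. dist (y k) (d (fst (prod_decode k))) < inverse (real (Suc k))"
    by metis
  have in_dom: "\<exists>g. op_pow T n (y k) = Some g" for n k
    using subsetD[OF YC y[of k]] by (simp add: C_infinity_iff dom_def)

  \<comment> \<open>One threshold serves both smallness conditions, as only finitely many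
    \<open>i \<le> k\<close> are involved. The bound 2^-k is summable, and remains small when
    multiplied by the \<open>k\<close> terms with \<open>i < k\<close>.\<close>
  have "\<exists>N. \<forall>n\<ge>N. norm ((B ^^ n) (y k)) < (1/2)^k \<and>
      (\<forall>i\<le>k. norm (the (op_pow T n (y i))) < (1/2)^k)"
    for k
  proof -
    have "\<forall>\<^sub>F n in sequentially. norm ((B ^^ n) (y k)) < (1/2)^k"
      using tendstoD[OF B0[OF y], of "(1/2)^k"] by simp
    moreover have "\<forall>\<^sub>F n in sequentially. \<forall>i\<in>{..k}. norm (the (op_pow T n (y i))) < (1/2)^k"
      using tendstoD[OF T0[OF y], of "(1/2)^k"] by (intro eventually_ball_finite) auto
    ultimately have "\<forall>\<^sub>F n in sequentially. norm ((B ^^ n) (y k)) < (1/2)^k \<and>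
        (\<forall>i\<le>k. norm (the (op_pow T n (y i))) < (1/2)^k)"
      by eventually_elim auto
    then show ?thesis by (simp add: eventually_sequentially)
  qed
  then obtain N where NB: "\<And>k n. n \<ge> N k \<Longrightarrow> norm ((B ^^ n) (y k)) < (1/2)^k"
    and NT: "\<And>k n i. n \<ge> N k \<Longrightarrow> i \<le> k \<Longrightarrow> norm (the (op_pow T n (y i))) < (1/2)^k"
    by metis
  \<comment> \<open>Cumulative sums make \<open>m k - m i\<close> exceed \<open>N k\<close> for
    every \<open>i < k\<close>, not only for the predecessor. The \<open>Suc\<close> makes
    \<open>m\<close> strictly increasing and positive even where \<open>N\<close> vanishes.\<close>
  define m where "m k = (\<Sum>i\<le>k. Suc (N i))" for k
  have m_diff: "m i + N k < m k" if "i < k" for i k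
  proof -
    have "m i + Suc (N k) = sum (\<lambda>i. Suc (N i)) (insert k {..i})"
      unfolding m_def using that by (subst sum.insert) auto
    also have "\<dots> \<le> m k"
      unfolding m_def using that by (intro sum_mono2) auto
    finally show ?thesis by simp
  qed
  have m_ge: "N k < m k" for k
    unfolding m_def by (cases k) auto
  have m_unbounded: "k \<le> m k" for k
  proof (induction k)
    case (Suc k)
    then show ?case using m_diff[of k "Suc k"] by simp
  qed simp

  define x where "x i = (B ^^ m i) (y i)" for i
  define f where "f = (\<Sum>i. x i)"
  have "norm (x i) \<le> (1/2)^i" for i
    unfolding x_def using NB[of i "m i"] m_ge[of i] by simp
  then have "summable x"
    by (intro summable_comparison_test'[OF summable_geometric[of "1/2 :: real"]]) auto
  then have x_sums: "x sums f"
    unfolding f_def by (rule summable_sums)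

  \<comment> \<open>At most 2^-k from each of the \<open>k\<close> earlier terms, 2 * 2^-k from the
    geometric tail, and the distance from \<open>y k\<close> to its target.\<close>
  define e where "e k = (real k + 2) * (1/2)^k + inverse (real (Suc k))" for k
  have approx: "\<exists>w. op_pow T (m k) f = Some w \<and> dist w (d (fst (prod_decode k))) \<le> e k" for k
  proof -
    define u where "u i = the (op_pow T (m k) (x i))" for i
    \<comment> \<open>At \<open>i = k\<close> the exponent difference is 0 and the value is
      \<open>y k\<close>, the main term.\<close>
    have u_gt: "op_pow T (m k) (x i) = Some ((B ^^ (m i - m k)) (y i))" if "i \<ge> k" for i
      unfolding x_def using that m_diff[of k i]
      by (intro op_pow_right_inverse_ge[OF BY TB y]) (cases "i = k"; simp)+
    have u_lt: "op_pow T (m k) (x i) = op_pow T (m k - m i) (y i)" if "i < k" for i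
      unfolding x_def using m_diff[OF that]
      by (intro op_pow_right_inverse_le[OF BY TB y]) auto
    have Tx: "op_pow T (m k) (x i) = Some (u i)" for i
      using u_gt[of i] u_lt[of i] in_dom[of "m k - m i" i] unfolding u_def
      by (cases "i < k") auto
    \<comment> \<open>Removing the main term leaves only the errors, so \<open>suminf v\<close> is
      the deviation from \<open>y k\<close>.\<close>
    define v where "v i = u i - (if i = k then y k else 0)" for i
    have v_lt: "norm (v i) \<le> (1/2)^k" if "i < k" for i
    proof -
      have "N k \<le> m k - m i" using m_diff[OF that] by simp
      with NT[of k "m k - m i" i] u_lt[OF that] that show ?thesis
        unfolding v_def u_def by simp
    qed
    have v_ge: "norm (v i) \<le> (1/2)^i" if "i \<ge> k" for i
    proof (cases "i = k")
      case True
      then show ?thesis using u_gt[of k] unfolding v_def u_def by simp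
    next
      case False
      then have "N i \<le> m i - m k" using that m_diff[of k i] by simp
      with NB[of i "m i - m k"] u_gt[OF that] False show ?thesis
        unfolding v_def u_def by simp
    qed
    have summ_v: "summable v"
      by (rule summable_comparison_test'[OF summable_geometric[of "1/2 :: real"], of k])
        (use v_ge in auto)
    have "(\<lambda>i. v i + (if i = k then y k else 0)) sums (suminf v + y k)"
      by (intro sums_add summable_sums summ_v sums_single)
    then have u_sums: "u sums (suminf v + y k)"
      unfolding v_def by simp
    \<comment> \<open>Closedness is available for positive powers only.\<close>
    have "m k \<ge> 1" using m_ge[of k] by simp
    then have Tf: "op_pow T (m k) f = Some (suminf v + y k)"
      by (intro closed_operator_sums[OF vs linear_operator_op_pow[OF vs lin] closed Tx x_sums u_sums])
    have geo: "(\<lambda>i. (1/2)^(i+k)) sums (2 * (1/2)^k :: real)"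
      using sums_mult2[OF geometric_sums[of "1/2::real"], of "(1/2)^k"] by (simp add: power_add)
    have "norm (suminf v) \<le> norm (\<Sum>i. v (i + k)) + norm (\<Sum>i<k. v i)"
      by (subst suminf_split_initial_segment[OF summ_v, of k]) (rule norm_triangle_ineq)
    also have "norm (\<Sum>i. v (i + k)) \<le> (\<Sum>i. (1/2)^(i+k))"
      using v_ge by (intro norm_suminf_le sums_summable[OF geo]) auto
    also have "\<dots> = 2 * (1/2)^k" using sums_unique[OF geo] by simp
    also have "norm (\<Sum>i<k. v i) \<le> real (card {..<k}) * (1/2)^k"
      using v_lt by (intro sum_norm_bound) auto
    finally have "norm (suminf v) \<le> (real k + 2) * (1/2)^k"
      by (simp add: algebra_simps)
    then have "dist (suminf v + y k) (y k) \<le> (real k + 2) * (1/2)^k"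
      by (simp add: dist_norm)
    with yd[of k] dist_triangle[of "suminf v + y k" "d (fst (prod_decode k))" "y k"]
    show ?thesis unfolding Tf e_def by auto
  qed

  have "(\<lambda>k. real k * (1/2)^k) \<longlonglongrightarrow> 0"
    using powser_times_n_limit_0[of "1/2 :: real"] by simp
  moreover have "(\<lambda>k. 2 * (1/2::real)^k) \<longlonglongrightarrow> 0"
    by (intro tendsto_mult_right_zero LIMSEQ_power_zero) simp
  ultimately have "(\<lambda>k. real k * (1/2)^k + 2 * (1/2)^k + inverse (real (Suc k))) \<longlonglongrightarrow> 0 + 0 + 0"
    by (intro tendsto_add LIMSEQ_inverse_real_of_nat)
  then have e0: "e \<longlonglongrightarrow> 0"
    unfolding e_def by (simp add: distrib_right)
  have dense_sub: "closure (range (\<lambda>k. the (op_pow T (m k) f))) = UNIV"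
    using approx by (intro dense_range_if_recurrent_approx[OF d e0]) (metis option.sel)
  have "closure (range (\<lambda>k. the (op_pow T (m k) f))) \<subseteq> closure (range (\<lambda>n. the (op_pow T n f)))"
    by (intro closure_mono) auto
  with dense_sub have orbit: "closure (range (\<lambda>n. the (op_pow T n f))) = UNIV"
    by auto
  \<comment> \<open>Domains shrink as the power grows and \<open>n \<le> m n\<close>, so definedness
    along \<open>m\<close> gives all powers.\<close>
  have "f \<in> dom (op_pow T n)" for n
    using approx[of n] dom_op_pow_antimono[OF m_unbounded[of n], of T] by blast
  moreover have "f \<noteq> 0"
  proof
    \<comment> \<open>The orbit of 0 is the closed set {0}, which is not dense in a nontrivial
      space.\<close>
    assume "f = 0"
    then have "op_pow T n f = Some 0" for n
      using linear_operator_op_pow[OF vs lin] unfolding linear_operator_iff[OF vs] by blast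
    with orbit nontriv show False by simp
  qed
  ultimately show ?thesis
    unfolding hypercyclic_def using lin orbit by blast
qed

section \<open>Transfer of the criterion to the powers of \<open>A\<close>\<close>

theorem corollary4p3:
  fixes smul :: "'k::real_normed_field \<Rightarrow> 'a::banach \<Rightarrow> 'a"
    and A :: "'a \<rightharpoonup> 'a"
    and Y :: "'a set"
    and B :: "'a \<Rightarrow> 'a"
  assumes "banach_space_over smul"
    and "infinite_dimensional smul"
    and "separable_space (euclidean :: 'a topology)"
    and "hypercyclic smul A"
    and "densely_defined A"
    and "\<And>n. n \<ge> 1 \<Longrightarrow> closed_operator (op_pow A n)"
    and "Y \<subseteq> C_infinity A"
    and "closure Y = UNIV"
    and "B \<in> Y \<rightarrow> Y"
    and "\<And>f. f \<in> Y \<Longrightarrow> A (B f) = Some f"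
    and "\<And>f. f \<in> Y \<Longrightarrow> (\<lambda>n. the (op_pow A n f)) \<longlonglongrightarrow> 0"
    and "\<And>f. f \<in> Y \<Longrightarrow> (\<lambda>n. (B ^^ n) f) \<longlonglongrightarrow> 0"
  shows "\<forall>n\<ge>1. hypercyclic smul (op_pow A n)"
proof (intro allI impI)
  fix n :: nat
  assume n: "n \<ge> 1"
  interpret banach_space_over smul by fact
  have vs: "vector_space smul" by unfold_locales
  \<comment> \<open>The space is nontrivial because a hypercyclic vector of \<open>A\<close> is
    nonzero.\<close>
  have lin: "linear_operator smul A" and nontriv: "(UNIV :: 'a set) \<noteq> {0}"
    using assms(4) unfolding hypercyclic_def by auto
  \<comment> \<open>The orbits under \<open>op_pow A n\<close> and \<open>B ^^ n\<close> are the
    subsequences at indices \<open>n * k\<close> of those under \<open>A\<close> and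
    \<open>B\<close>, so they inherit the limit 0.\<close>
  have sub: "strict_mono (\<lambda>k. n * k)"
    using n by (simp add: strict_mono_def)
  have iter: "(B ^^ n) ^^ k = B ^^ (n * k)" for k
    by (simp add: funpow_mult mult.commute)
  show "hypercyclic smul (op_pow A n)"
  proof (rule hypercyclicity_criterion[where Y = Y and B = "B ^^ n", OF vs assms(3) nontriv])
    show "linear_operator smul (op_pow A n)"
      by (rule linear_operator_op_pow[OF vs lin])
    show "closed_operator (op_pow (op_pow A n) k)" if "k \<ge> 1" for k
      using that n by (simp flip: op_pow_mult add: assms(6))
    show "Y \<subseteq> C_infinity (op_pow A n)"
      using assms(7) by (auto simp: C_infinity_iff dom_def simp flip: op_pow_mult)
    show "closure Y = UNIV" by fact
    have "(B ^^ k) f \<in> Y" if "f \<in> Y" for f k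
      using that assms(9) by (induction k) auto
    then show "B ^^ n \<in> Y \<rightarrow> Y" by auto
    fix f assume f: "f \<in> Y"
    show "op_pow A n ((B ^^ n) f) = Some f"
      using op_pow_right_inverse_ge[OF assms(9,10) f order.refl] by simp
    show "(\<lambda>k. the (op_pow (op_pow A n) k f)) \<longlonglongrightarrow> 0"
      using LIMSEQ_subseq_LIMSEQ[OF assms(11)[OF f] sub] by (simp add: o_def op_pow_mult)
    show "(\<lambda>k. ((B ^^ n) ^^ k) f) \<longlonglongrightarrow> 0"
      using LIMSEQ_subseq_LIMSEQ[OF assms(12)[OF f] sub] by (simp add: o_def iter)
  qed
qed

end
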